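(* Let $X$ and $Y$ be locally path-connected metric spaces with metrics $d_X,d_Y$, let $\Omega\subset X$ and $\Omega'\subset Y$ be domains, and let $f:\Omega\to\Omega'$ be a homeomorphism. Then $f$ is BQS with respect to the metrics $d_X$ on $\Omega$ and $d_Y$ on $\Omega'$ if and only if it is BQS with respect to the corresponding Mazurkiewicz metrics $d_M$ on $\Omega$ and $d_M'$ on $\Omega'$.
   Context: A domain is a non-empty open connected set. A continuum is a compact connected set; it is nondegenerate if it has at least two points. The Mazurkiewicz metric on $\Omega$ is $d_M(x,y)=\inf_E\operatorname{diam}(E)$, the infimum over all continua $E\subset\Omega$ containing $x$ and $y$, with diameters in $d_X$; $d_M'$ is defined in the same way on $\Omega'$ using $d_Y$. (For domains in locally path-connected spaces these are finite metrics inducing the original topologies.) Given metrics on $\Omega$ and $\Omega'$, a homeomorphism $f:\Omega\to\Omega'$ is a branched quasisymmetric (BQS) homeomorphism with respect to them if there is a monotone increasing $\eta:(0,\infty)\to(0,\infty)$ with $\lim_{t\to0^+}\eta(t)=0$ such that for all nondegenerate continua $E,F\subset\Omega$ with $E\cap F\neq\emptyset$, $\frac{\operatorname{diam} f(E)}{\operatorname{diam} f(F)}\le\eta\left(\frac{\operatorname{diam}E}{\operatorname{diam}F}\right)$, the diameters being taken in the given metrics. *)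

theory Defs
  imports "HOL-Analysis.Analysis"
begin

definition continuum_in :: "'a topology \<Rightarrow> 'a set \<Rightarrow> bool" where
  "continuum_in T E \<longleftrightarrow> compactin T E \<and> connectedin T E"

definition nondegenerate :: "'a set \<Rightarrow> bool" where
  "nondegenerate E \<longleftrightarrow> (\<exists>x\<in>E. \<exists>y\<in>E. x \<noteq> y)"

definition is_domain :: "'a::topological_space set \<Rightarrow> bool" where
  "is_domain U \<longleftrightarrow> open U \<and> connected U \<and> U \<noteq> {}"

text \<open>The library constant \<^const>\<open>diameter\<close> is tied to \<^const>\<open>dist\<close>; this is the same
  definition for an explicitly given metric. It is only meaningful on sets bounded for
  \<open>d\<close>, such as continua.\<close>

definition diam_wrt :: "('a \<Rightarrow> 'a \<Rightarrow> real) \<Rightarrow> 'a set \<Rightarrow> real" where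
  "diam_wrt d S = (if S = {} then 0 else SUP (x, y)\<in>S \<times> S. d x y)"

lemma diam_wrt_dist: "diam_wrt dist S = diameter S"
  by (simp add: diam_wrt_def diameter_def)

text \<open>The value \<open>0\<close> outside \<open>U\<close> is a convention: the locale \<^locale>\<open>Metric_space\<close> asks for
  nonnegativity and symmetry also off the carrier, where the infimum would be over
  the empty set.\<close>

definition mazurkiewicz :: "'a::metric_space set \<Rightarrow> 'a \<Rightarrow> 'a \<Rightarrow> real" where
  "mazurkiewicz U x y =
     (if x \<in> U \<and> y \<in> U
      then Inf {diameter E | E. continuum_in euclidean E \<and> E \<subseteq> U \<and> x \<in> E \<and> y \<in> E}
      else 0)"

text \<open>Homeomorphisms and continua are taken in the topologies induced by the given
  metrics \<open>d\<close> on \<open>U\<close> and \<open>d'\<close> on \<open>V\<close>. The values of \<open>\<eta>\<close> outside \<open>(0, \<infinity>)\<close> are irrelevant;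
  increasing is meant in the weak sense.\<close>

definition BQS_homeo ::
  "'a set \<Rightarrow> ('a \<Rightarrow> 'a \<Rightarrow> real) \<Rightarrow> 'b set \<Rightarrow> ('b \<Rightarrow> 'b \<Rightarrow> real) \<Rightarrow> ('a \<Rightarrow> 'b) \<Rightarrow> bool" where
  "BQS_homeo U d V d' f \<longleftrightarrow>
     Metric_space U d \<and> Metric_space V d' \<and>
     homeomorphic_map (Metric_space.mtopology U d) (Metric_space.mtopology V d') f \<and>
     (\<exists>\<eta> :: real \<Rightarrow> real.
        (\<forall>t>0. \<eta> t > 0) \<and> mono_on {0<..} \<eta> \<and> (\<eta> \<longlongrightarrow> 0) (at_right 0) \<and>
        (\<forall>E F. continuum_in (Metric_space.mtopology U d) E \<and> nondegenerate E \<and>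
               continuum_in (Metric_space.mtopology U d) F \<and> nondegenerate F \<and>
               E \<inter> F \<noteq> {} \<longrightarrow>
           diam_wrt d' (f ` E) / diam_wrt d' (f ` F) \<le> \<eta> (diam_wrt d E / diam_wrt d F)))"

end

theory Submission
  imports Defs
begin

text \<open>For a continuum \<open>E \<subseteq> \<Omega>\<close> and \<open>x, y \<in> E\<close> we have
  \<open>dist x y \<le> mazurkiewicz \<Omega> x y \<le> diameter E\<close>, the second inequality because \<open>E\<close> itself
  competes in the infimum. So the Mazurkiewicz metric does not change the diameters of continua.
  By local path-connectedness it does not change the topology either, hence neither the
  continua, and the two BQS conditions are literally the same.\<close>

section \<open>Continua and their diameters\<close>

lemma mazurkiewicz_commute: "mazurkiewicz U x y = mazurkiewicz U y x"
  unfolding mazurkiewicz_def by (simp add: conj_ac)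

lemma mazurkiewicz_le_diameter:
  assumes "continuum_in euclidean E" "E \<subseteq> U" "x \<in> E" "y \<in> E"
  shows "mazurkiewicz U x y \<le> diameter E"
proof -
  have "bdd_below {diameter E | E. continuum_in euclidean E \<and> E \<subseteq> U \<and> x \<in> E \<and> y \<in> E}"
    by (rule bdd_belowI[of _ 0])
      (auto simp: continuum_in_def intro!: diameter_ge_0 compact_imp_bounded)
  then show ?thesis
    using assms unfolding mazurkiewicz_def by (auto intro!: cInf_lower)
qed

lemma continuum_path_image:
  assumes "path g"
  shows "continuum_in euclidean (path_image g)"
  using assms by (simp add: continuum_in_def compact_path_image connected_path_image)

text \<open>Identifies the continua quantified over in \<open>BQS_homeo\<close>, once its topology
  is the subspace topology, with the sets competing in the Mazurkiewicz infimum.\<close>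

lemma continuum_in_top_of_set:
  "continuum_in (top_of_set U) E \<longleftrightarrow> continuum_in euclidean E \<and> E \<subseteq> U"
  by (auto simp: continuum_in_def compactin_subtopology connectedin_subtopology)

lemma continuum_in_continuous_map_image:
  assumes "continuous_map S T f" "continuum_in S E"
  shows "continuum_in T (f ` E)"
  using assms
  by (auto simp: continuum_in_def intro: image_compactin connectedin_continuous_map_image)

lemma continuum_Un:
  assumes "continuum_in T E" "continuum_in T F" "E \<inter> F \<noteq> {}"
  shows "continuum_in T (E \<union> F)"
  using assms by (auto simp: continuum_in_def intro!: compactin_Un connectedin_Un)

lemma diameter_least:
  fixes S :: "'a::metric_space set"
  assumes "S \<noteq> {}" "\<And>x y. \<lbrakk>x \<in> S; y \<in> S\<rbrakk> \<Longrightarrow> dist x y \<le> c"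
  shows "diameter S \<le> c"
  using assms unfolding diameter_def by (auto intro!: cSUP_least)

text \<open>A common point \<open>z\<close> links a point of \<open>E\<close> to a point of
  \<open>F\<close> by the triangle inequality; two points of the same set need only that the other
  diameter is nonnegative.\<close>

lemma diameter_Un_le:
  fixes E F :: "'a::metric_space set"
  assumes "bounded E" "bounded F" "E \<inter> F \<noteq> {}"
  shows "diameter (E \<union> F) \<le> diameter E + diameter F"
proof -
  obtain z where z: "z \<in> E" "z \<in> F"
    using assms(3) by auto
  have EF: "dist x y \<le> diameter E + diameter F" if "x \<in> E" "y \<in> F" for x y
    using diameter_bounded_bound[OF assms(1) that(1) z(1)]
      diameter_bounded_bound[OF assms(2) z(2) that(2)] dist_triangle[of x y z]
    by linarith
  have "dist x y \<le> diameter E + diameter F" if "x \<in> E \<union> F" "y \<in> E \<union> F" for x y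
    using that EF[of x y] EF[of y x] diameter_bounded_bound[OF assms(1), of x y]
      diameter_bounded_bound[OF assms(2), of x y] diameter_ge_0[OF assms(1)]
      diameter_ge_0[OF assms(2)]
    by (auto simp: dist_commute)
  then show ?thesis
    using z by (intro diameter_least) auto
qed

section \<open>Path-connected domains and lower bounds for the infimum\<close>

lemma is_domain_imp_path_connected:
  fixes U :: "'a::metric_space set"
  assumes "locally path_connected (UNIV :: 'a set)" "is_domain U"
  shows "path_connected U"
proof -
  \<comment> \<open>Local path-connectedness passes to open subsets, and there path components and
    connected components coincide.\<close>
  have "locally path_connected U"
    using assms by (auto simp: is_domain_def intro: locally_open_subset)
  then have "path_component U x = connected_component U x" for x
    by (rule path_component_eq_connected_component)
  then show ?thesis
    using assms(2)
    by (simp add: is_domain_def path_connected_component connected_iff_connected_component)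
qed

lemma ex_continuum_in_domain:
  fixes U :: "'a::metric_space set"
  assumes "locally path_connected (UNIV :: 'a set)" "is_domain U" "x \<in> U" "y \<in> U"
  obtains E where "continuum_in euclidean E" "E \<subseteq> U" "x \<in> E" "y \<in> E"
proof -
  obtain g where "path g" "path_image g \<subseteq> U" "pathstart g = x" "pathfinish g = y"
    using is_domain_imp_path_connected[OF assms(1,2)] assms(3,4)
    unfolding path_connected_def by blast
  then show ?thesis
    using that[of "path_image g"] continuum_path_image
    by (metis pathstart_in_path_image pathfinish_in_path_image)
qed

text \<open>Path-connectedness supplies a competitor, so the infimum is over a nonempty set and
  every lower bound of the diameters is below it.\<close>

lemma mazurkiewicz_greatest:
  fixes U :: "'a::metric_space set"
  assumes "locally path_connected (UNIV :: 'a set)" "is_domain U" "x \<in> U" "y \<in> U"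
    and "\<And>E. \<lbrakk>continuum_in euclidean E; E \<subseteq> U; x \<in> E; y \<in> E\<rbrakk> \<Longrightarrow> c \<le> diameter E"
  shows "c \<le> mazurkiewicz U x y"
proof -
  have "{diameter E | E. continuum_in euclidean E \<and> E \<subseteq> U \<and> x \<in> E \<and> y \<in> E} \<noteq> {}"
    using ex_continuum_in_domain[OF assms(1-4)] by blast
  then show ?thesis
    using assms(3-5) unfolding mazurkiewicz_def by (auto intro!: cInf_greatest)
qed

lemma dist_le_mazurkiewicz:
  fixes U :: "'a::metric_space set"
  assumes "locally path_connected (UNIV :: 'a set)" "is_domain U" "x \<in> U" "y \<in> U"
  shows "dist x y \<le> mazurkiewicz U x y"
  using assms
  by (intro mazurkiewicz_greatest)
    (auto simp: continuum_in_def intro: diameter_bounded_bound compact_imp_bounded)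

section \<open>The metric axioms\<close>

lemma mazurkiewicz_triangle:
  fixes U :: "'a::metric_space set"
  assumes lpc: "locally path_connected (UNIV :: 'a set)" and dom: "is_domain U"
    and "x \<in> U" "y \<in> U" "z \<in> U"
  shows "mazurkiewicz U x z \<le> mazurkiewicz U x y + mazurkiewicz U y z"
proof -
  \<comment> \<open>\<open>E\<close> and \<open>F\<close> share \<open>y\<close>, so their union is
    connected and competes for \<open>x\<close> and \<open>z\<close>.\<close>
  have "mazurkiewicz U x z \<le> diameter E + diameter F"
    if E: "continuum_in euclidean E" "E \<subseteq> U" "x \<in> E" "y \<in> E"
      and F: "continuum_in euclidean F" "F \<subseteq> U" "y \<in> F" "z \<in> F" for E F
  proof -
    have "mazurkiewicz U x z \<le> diameter (E \<union> F)"
      using E F by (intro mazurkiewicz_le_diameter continuum_Un) auto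
    also have "\<dots> \<le> diameter E + diameter F"
      using E F by (intro diameter_Un_le) (auto simp: continuum_in_def compact_imp_bounded)
    finally show ?thesis .
  qed
  \<comment> \<open>The sum is split so that the infimum can be taken over one continuum at a time:
    first over \<open>F\<close> with \<open>E\<close> fixed, then over \<open>E\<close>.\<close>
  then have "mazurkiewicz U x z - diameter E \<le> diameter F"
    if "continuum_in euclidean E" "E \<subseteq> U" "x \<in> E" "y \<in> E"
      and "continuum_in euclidean F" "F \<subseteq> U" "y \<in> F" "z \<in> F" for E F
    using that by (metis diff_le_eq add.commute)
  then have "mazurkiewicz U x z - diameter E \<le> mazurkiewicz U y z"
    if "continuum_in euclidean E" "E \<subseteq> U" "x \<in> E" "y \<in> E" for E
    using that assms by (intro mazurkiewicz_greatest) auto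
  then have "mazurkiewicz U x z - mazurkiewicz U y z \<le> mazurkiewicz U x y"
    using assms by (intro mazurkiewicz_greatest) (auto simp: diff_le_eq add.commute)
  then show ?thesis by simp
qed

lemma Metric_space_mazurkiewicz:
  fixes U :: "'a::metric_space set"
  assumes lpc: "locally path_connected (UNIV :: 'a set)" and dom: "is_domain U"
  shows "Metric_space U (mazurkiewicz U)"
proof
  fix x y :: 'a
  show "0 \<le> mazurkiewicz U x y"
  proof (cases "x \<in> U \<and> y \<in> U")
    case True
    then show ?thesis
      using dist_le_mazurkiewicz[OF lpc dom, of x y] by (meson order_trans zero_le_dist)
  qed (auto simp: mazurkiewicz_def)
  show "mazurkiewicz U x y = mazurkiewicz U y x"
    by (rule mazurkiewicz_commute)
next
  fix x y assume xy: "x \<in> U" "y \<in> U"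
  \<comment> \<open>The singleton is a continuum of diameter 0.\<close>
  have "mazurkiewicz U x x \<le> 0"
    using xy mazurkiewicz_le_diameter[of "{x}" U x x] by (simp add: continuum_in_def)
  then show "mazurkiewicz U x y = 0 \<longleftrightarrow> x = y"
    using dist_le_mazurkiewicz[OF lpc dom xy] dist_le_mazurkiewicz[OF lpc dom xy(1) xy(1)] by auto
qed (rule mazurkiewicz_triangle[OF lpc dom])

section \<open>Comparison of the topologies\<close>

lemma Metric_space_dist: "Metric_space U dist"
  by (rule Met_TC.subspace) simp

lemma mtopology_dist: "Metric_space.mtopology U dist = top_of_set U"
proof -
  interpret Submetric UNIV dist U
    by unfold_locales simp
  show ?thesis
    using mtopology_submetric by simp
qed

text \<open>By local path-connectedness, points near \<open>x\<close> are reached by paths that stay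
  near \<open>x\<close> and inside \<open>U\<close>; their images are competitors of small
  diameter.\<close>

lemma mazurkiewicz_small:
  fixes U :: "'a::metric_space set"
  assumes lpc: "locally path_connected (UNIV :: 'a set)" and "open U" "x \<in> U" "r > 0"
  obtains e where "e > 0" "ball x e \<subseteq> U" "\<And>y. y \<in> ball x e \<Longrightarrow> mazurkiewicz U x y < r"
proof -
  \<comment> \<open>Radius \<open>r / 3\<close> bounds the diameter of a path image in the ball by
    \<open>2 * (r / 3)\<close>, which is strictly below \<open>r\<close>.\<close>
  define W where "W = path_component_set (ball x (r / 3) \<inter> U) x"
  have "open W" "x \<in> W"
    using locally_path_connected_2[OF lpc, of "ball x (r / 3) \<inter> U" x] assms
    by (auto simp: W_def open_Int path_component_refl)
  then obtain e where e: "e > 0" "ball x e \<subseteq> W"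
    by (auto simp: open_contains_ball)
  have "mazurkiewicz U x y < r" if y: "y \<in> ball x e" for y
  proof -
    obtain g where g: "path g" "path_image g \<subseteq> ball x (r / 3) \<inter> U"
        "pathstart g = x" "pathfinish g = y"
      using y e unfolding W_def path_component_def by blast
    have "mazurkiewicz U x y \<le> diameter (path_image g)"
      using g by (intro mazurkiewicz_le_diameter continuum_path_image)
        (auto simp: pathstart_in_path_image pathfinish_in_path_image)
    also have "\<dots> \<le> 2 * (r / 3)"
    proof -
      have "dist a b \<le> 2 * (r / 3)" if "a \<in> path_image g" "b \<in> path_image g" for a b
      proof -
        have "dist x a < r / 3" "dist x b < r / 3"
          using that g(2) by auto
        then show ?thesis
          using dist_triangle[of a b x] by (simp add: dist_commute)
      qed
      then show ?thesis
        by (intro diameter_least) auto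
    qed
    also have "\<dots> < r"
      using \<open>r > 0\<close> by simp
    finally show ?thesis .
  qed
  moreover have "W \<subseteq> U"
    using path_component_subset[of "ball x (r / 3) \<inter> U" x] by (auto simp: W_def)
  ultimately show ?thesis
    using e that by blast
qed

text \<open>Each Mazurkiewicz ball contains a metric ball about the same centre by
  \<open>mazurkiewicz_small\<close>; conversely \<open>dist_le_mazurkiewicz\<close> puts each
  Mazurkiewicz ball inside the metric ball of the same radius.\<close>

lemma mtopology_mazurkiewicz:
  fixes U :: "'a::metric_space set"
  assumes lpc: "locally path_connected (UNIV :: 'a set)" and dom: "is_domain U"
  shows "Metric_space.mtopology U (mazurkiewicz U) = top_of_set U"
proof -
  interpret M: Metric_space U "mazurkiewicz U"
    by (rule Metric_space_mazurkiewicz[OF lpc dom])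
  have "open U"
    using dom by (simp add: is_domain_def)
  have "openin M.mtopology S \<longleftrightarrow> openin (top_of_set U) S" for S
  proof
    assume S: "openin M.mtopology S"
    then have "S \<subseteq> U"
      by (simp add: M.openin_mtopology)
    have "\<exists>e>0. ball x e \<subseteq> S" if "x \<in> S" for x
    proof -
      obtain r where r: "r > 0" "M.mball x r \<subseteq> S"
        using S \<open>x \<in> S\<close> unfolding M.openin_mtopology by blast
      obtain e where "e > 0" "ball x e \<subseteq> U" "\<And>y. y \<in> ball x e \<Longrightarrow> mazurkiewicz U x y < r"
        using mazurkiewicz_small[OF lpc \<open>open U\<close>, of x r] \<open>S \<subseteq> U\<close> \<open>x \<in> S\<close> r by blast
      then have "ball x e \<subseteq> M.mball x r"
        using \<open>S \<subseteq> U\<close> that by (auto simp del: mem_ball)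
      then show ?thesis
        using r \<open>e > 0\<close> by blast
    qed
    then show "openin (top_of_set U) S"
      using \<open>S \<subseteq> U\<close> by (simp add: open_contains_ball open_subset)
  next
    assume "openin (top_of_set U) S"
    \<comment> \<open>Since \<open>U\<close> is open, relatively open subsets are open in the whole
      space.\<close>
    then have S: "open S" "S \<subseteq> U"
      using \<open>open U\<close> by (auto simp: openin_open_eq)
    have "\<exists>r>0. M.mball x r \<subseteq> S" if "x \<in> S" for x
    proof -
      obtain r where r: "r > 0" "ball x r \<subseteq> S"
        using S \<open>x \<in> S\<close> by (auto simp: open_contains_ball)
      have "M.mball x r \<subseteq> ball x r"
        using dist_le_mazurkiewicz[OF lpc dom] by force
      with r show ?thesis by blast
    qed
    then show "openin M.mtopology S"
      using S by (simp add: M.openin_mtopology)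
  qed
  then show ?thesis
    by (simp add: topology_eq)
qed

section \<open>Equality of diameters and of the two BQS conditions\<close>

lemma diam_wrt_mazurkiewicz:
  fixes U :: "'a::metric_space set"
  assumes lpc: "locally path_connected (UNIV :: 'a set)" and dom: "is_domain U"
    and E: "continuum_in euclidean E" "E \<subseteq> U"
  shows "diam_wrt (mazurkiewicz U) E = diam_wrt dist E"
proof (cases "E = {}")
  case False
  have "(SUP (x, y)\<in>E \<times> E. mazurkiewicz U x y) = diameter E"
  proof (rule antisym)
    show "(SUP (x, y)\<in>E \<times> E. mazurkiewicz U x y) \<le> diameter E"
      using False E by (auto intro!: cSUP_least mazurkiewicz_le_diameter)
    \<comment> \<open>A real supremum dominates its terms only if the family is bounded above;
      \<open>diameter E\<close> is such a bound.\<close>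
    have "bdd_above ((\<lambda>(x, y). mazurkiewicz U x y) ` (E \<times> E))"
      using E by (auto intro!: bdd_aboveI[of _ "diameter E"] mazurkiewicz_le_diameter)
    then show "diameter E \<le> (SUP (x, y)\<in>E \<times> E. mazurkiewicz U x y)"
      using False E dist_le_mazurkiewicz[OF lpc dom] unfolding diameter_def
      by (auto simp: Bex_def intro!: cSUP_mono) blast
  qed
  then show ?thesis
    using False by (simp add: diam_wrt_dist) (simp add: diam_wrt_def)
qed (simp add: diam_wrt_def)

theorem proposition4p12:
  fixes f :: "'a::metric_space \<Rightarrow> 'b::metric_space"
    and \<Omega> :: "'a set" and \<Omega>' :: "'b set"
  assumes "locally path_connected (UNIV :: 'a set)"
    and "locally path_connected (UNIV :: 'b set)"
    and "is_domain \<Omega>" and "is_domain \<Omega>'"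
    and "homeomorphic_map (top_of_set \<Omega>) (top_of_set \<Omega>') f"
  shows "BQS_homeo \<Omega> dist \<Omega>' dist f \<longleftrightarrow>
         BQS_homeo \<Omega> (mazurkiewicz \<Omega>) \<Omega>' (mazurkiewicz \<Omega>') f"
proof -
  have "continuous_map (top_of_set \<Omega>) (top_of_set \<Omega>') f"
    using assms(5) by (rule homeomorphic_imp_continuous_map)
  then have diam: "diam_wrt (mazurkiewicz \<Omega>) E = diam_wrt dist E"
      "diam_wrt (mazurkiewicz \<Omega>') (f ` E) = diam_wrt dist (f ` E)"
    if "continuum_in (top_of_set \<Omega>) E" for E
    using that continuum_in_continuous_map_image[of "top_of_set \<Omega>" "top_of_set \<Omega>'" f E] assms
    by (auto simp: continuum_in_top_of_set intro!: diam_wrt_mazurkiewicz)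
  show ?thesis
    \<comment> \<open>With both topologies rewritten to subspace topologies, the homeomorphism
      condition and the continua agree, and \<open>diam\<close> matches all four diameters, so the
      same \<open>\<eta>\<close> serves both sides.\<close>
    using assms unfolding BQS_homeo_def
    by (simp add: mtopology_dist mtopology_mazurkiewicz Metric_space_dist
        Metric_space_mazurkiewicz diam cong: conj_cong)
qed

end
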